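(* Every minimally $1$-tough graph of order $n$ with girth $4$ has a vertex of degree at most $\frac{n+6}{4}$.
   Context: All graphs are finite, simple and undirected. The order $n$ of a graph is its number of vertices; the girth is the length of a shortest cycle. For a graph $G$ and $S\subseteq V(G)$, $w(G-S)$ denotes the number of connected components of $G-S$. The toughness of a noncomplete graph $G$ is $\tau(G)=\min\left\{\frac{|S|}{w(G-S)} : S\subseteq V(G),\ w(G-S)\ge 2\right\}$, and $\tau(G)=+\infty$ if $G$ is complete. A graph $G$ is minimally $t$-tough if $\tau(G)=t$ and $\tau(G-e)<t$ for every edge $e\in E(G)$, where $G-e$ is $G$ with the edge $e$ deleted. *)

theory Defs
  imports "Graph_Theory.Graph_Theory" "HOL-Library.Extended_Real"
begin

text \<open>
  A finite simple undirected graph is a \<^locale>\<open>pair_graph\<close>: a finite, symmetric, loopfree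
  set of pairs, in which the edge \<open>uv\<close> is the pair of arcs \<open>(u,v)\<close> and \<open>(v,u)\<close>.
  Hence the degree of a vertex is its \<^const>\<open>out_degree\<close>, and the connected components are
  the strongly connected ones (\<^const>\<open>pre_digraph.sccs\<close>).
\<close>

definition num_components :: "('a, 'b) pre_digraph \<Rightarrow> nat" where
  "num_components G = card (pre_digraph.sccs G)"

definition delete_vertices :: "'a pair_pre_digraph \<Rightarrow> 'a set \<Rightarrow> ('a, 'a \<times> 'a) pre_digraph" where
  "delete_vertices G S = with_proj G \<restriction> (pverts G - S)"

definition delete_edge :: "'a pair_pre_digraph \<Rightarrow> 'a \<times> 'a \<Rightarrow> 'a pair_pre_digraph" where
  "delete_edge G e = G\<lparr> parcs := parcs G - {(fst e, snd e), (snd e, fst e)} \<rparr>"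

definition toughness :: "'a pair_pre_digraph \<Rightarrow> ereal" where
  "toughness G =
    (if complete_digraph (card (pverts G)) (with_proj G) then \<infinity>
     else Min {ereal (real (card S) / real (num_components (delete_vertices G S))) | S.
                 S \<subseteq> pverts G \<and> num_components (delete_vertices G S) \<ge> 2})"

definition minimally_tough :: "real \<Rightarrow> 'a pair_pre_digraph \<Rightarrow> bool" where
  "minimally_tough t G \<longleftrightarrow>
     toughness G = ereal t \<and> (\<forall>e \<in> parcs G. toughness (delete_edge G e) < ereal t)"

text \<open>
  \<^const>\<open>pre_digraph.cycle\<close> also admits the closed walk \<open>u, v, u\<close> along a single edge;
  requiring length at least 3 leaves exactly the cycles of the undirected graph.
  The girth of an acyclic graph is \<open>\<infinity>\<close>.
\<close>

definition girth :: "'a pair_pre_digraph \<Rightarrow> enat" where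
  "girth G = (INF p \<in> {p. pre_digraph.cycle (with_proj G) p \<and> length p \<ge> 3}. enat (length p))"

end

(* Suppose every degree is at least d with 4 d >= n + 7. For an edge uv pick S with more than
   k = |S| components in (G - uv) - S. As G is triangle-free, a component with an edge has at least
   2 d - k - 1 vertices, so counting vertices leaves room for only one such component: there are at
   least k isolated vertices I, with all neighbours in S apart from the edge uv, and k <= 2 d - 4.

   By double counting, some s in S has at least d neighbours in I; take such a neighbour x outside
   {u, v}, and let (S', I') be the corresponding pair for the edge xs. If s lies in I', then S'
   contains d - 1 vertices of I, which forces I' into S; but x is adjacent to no vertex of I' other
   than s, so it has too few neighbours. Otherwise x lies in I', and the two pairs are uncrossed:
   in the graph without W = (S - I') + (S' - I), the vertices of (I - S') + (I' - S) are isolated up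
   to the edge uv. Toughness gives |S meet S'| <= |I meet I'| + 1 + (k - |I|), whereas the degree of
   x bounds |S meet S'| below by d - 1 and the neighbours of s bound |I meet I'| above by
   |I| - d + 1; together these give k >= 2 d - 3. *)

theory Submission
  imports Defs
begin

section \<open>Components of induced subgraphs, as reachability classes of a relation\<close>

definition components :: "'a set \<Rightarrow> 'a rel \<Rightarrow> 'a set set" where
  "components U A = (\<lambda>v. (A \<inter> U \<times> U)\<^sup>* `` {v}) ` U"

definition isolated :: "'a set \<Rightarrow> 'a rel \<Rightarrow> 'a set" where
  "isolated U A = {y \<in> U. \<forall>z \<in> U. (y, z) \<notin> A}"

text \<open>Since \<open>parcs G\<close> is symmetric, reachability is an equivalence, so strong
  components are reachability classes. From here on, deleting vertices changes only \<open>U\<close>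
  and deleting an edge changes only \<open>A\<close>.\<close>

lemma num_components_delete_vertices:
  assumes "pair_graph G"
  shows "num_components (delete_vertices G S) = card (components (pverts G - S) (parcs G))"
proof -
  interpret pair_graph G by fact
  let ?U = "pverts G - S"
  let ?H = "delete_vertices G S"
  let ?R = "parcs G \<inter> ?U \<times> ?U"
  have verts: "verts ?H = ?U"
    by (simp add: delete_vertices_def)
  have ends: "arcs_ends ?H = ?R"
    by (auto simp: delete_vertices_def arcs_ends_def arc_to_ends_def induce_subgraph_def)
  interpret H: wf_digraph ?H
    unfolding delete_vertices_def by (rule wellformed_induce_subgraph)
  have "sym ?R"
    using pair_sym_arcs by (auto simp: symmetric_def sym_def)
  then have sym: "sym (?R\<^sup>*)"
    by (rule sym_rtrancl)
  have reach: "u \<rightarrow>\<^sup>*\<^bsub>?H\<^esub> v \<longleftrightarrow> (u, v) \<in> ?R\<^sup>*" if "u \<in> ?U" for u v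
  proof
    show "(u, v) \<in> ?R\<^sup>*" if "u \<rightarrow>\<^sup>*\<^bsub>?H\<^esub> v"
      using that rtrancl_on_sub_rtrancl unfolding reachable_def verts ends by blast
    show "u \<rightarrow>\<^sup>*\<^bsub>?H\<^esub> v" if "(u, v) \<in> ?R\<^sup>*"
      using that
    proof (induction rule: rtrancl_induct)
      case base
      then show ?case using \<open>u \<in> ?U\<close> verts by (simp add: H.reachable_refl)
    next
      case (step y z)
      then show ?case using H.reachable_adj_trans ends by metis
    qed
  qed
  have in_U: "w \<in> ?U" if "(v, w) \<in> ?R\<^sup>*" "v \<in> ?U" for v w
    using that by (induction rule: rtrancl_induct) auto
  have "pre_digraph.scc_of ?H v = ?R\<^sup>* `` {v}" if "v \<in> ?U" for v
    using that reach in_U sym by (auto simp: pre_digraph.scc_of_def dest: symD H.reachable_in_verts)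
  then have "pre_digraph.sccs_verts ?H = components ?U (parcs G)"
    unfolding H.sccs_verts_conv_scc_of components_def verts by (intro image_cong) auto
  then show ?thesis
    unfolding num_components_def using H.card_sccs_verts by simp
qed

lemma components_memb_subset:
  assumes "C \<in> components U A"
  shows "C \<subseteq> U"
proof
  fix y assume "y \<in> C"
  then obtain v where "v \<in> U" "(v, y) \<in> (A \<inter> U \<times> U)\<^sup>*"
    using assms by (auto simp: components_def)
  from this(2,1) show "y \<in> U" by (induction rule: rtrancl_induct) auto
qed

lemma disjoint_components:
  assumes "sym A"
  shows "disjoint (components U A)"
proof -
  let ?R = "(A \<inter> U \<times> U)\<^sup>*"
  have "sym (A \<inter> U \<times> U)" using assms by (auto simp: sym_def)
  then have sym: "(y, x) \<in> ?R" if "(x, y) \<in> ?R" for x y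
    using that sym_rtrancl symD by metis
  have "?R `` {x} = ?R `` {y}" if "(x, z) \<in> ?R" "(y, z) \<in> ?R" for x y z
    using that sym by (blast intro: rtrancl_trans)
  then show ?thesis
    unfolding components_def pairwise_def disjnt_def by (fast dest!: ImageE)
qed

lemma card_le_card_components:
  assumes "finite U" "J \<subseteq> U"
    and "\<And>x y. \<lbrakk>x \<in> J; y \<in> J; x \<noteq> y\<rbrakk> \<Longrightarrow> (x, y) \<notin> (A \<inter> U \<times> U)\<^sup>*"
  shows "card J \<le> card (components U A)"
proof (rule card_inj_on_le)
  show "inj_on (\<lambda>v. (A \<inter> U \<times> U)\<^sup>* `` {v}) J"
    using assms(3) by (intro inj_onI) blast
qed (use assms in \<open>auto simp: components_def\<close>)

text \<open>Inside \<open>U\<close> a vertex of \<open>J\<close> has at most the edge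
  \<open>uv\<close>. Once \<open>u\<close> is discarded, no two vertices of \<open>J\<close> share a
  component; the summand 1 pays for \<open>u\<close>.\<close>

lemma card_almost_isolated_le:
  assumes "finite U" "sym A" "J \<subseteq> U"
    and nbr: "\<And>y z. \<lbrakk>y \<in> J; z \<in> U; (y, z) \<in> A\<rbrakk> \<Longrightarrow> {y, z} = {u, v}"
  shows "card J \<le> card (components U A) + 1"
proof -
  have "card (J - {u}) \<le> card (components U A)"
  proof (rule card_le_card_components)
    fix x y assume xy: "x \<in> J - {u}" "y \<in> J - {u}" "x \<noteq> y"
    show "(x, y) \<notin> (A \<inter> U \<times> U)\<^sup>*"
    proof
      assume path: "(x, y) \<in> (A \<inter> U \<times> U)\<^sup>*"
      show False
      \<comment> \<open>At least one of the two ends of the path differs from \<open>v\<close>, and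
        from \<open>u\<close> by the choice of \<open>x\<close> and \<open>y\<close>; the path's
        edge at that end would have to be \<open>uv\<close>.\<close>
      proof (cases "x = v")
        case True
        from path xy(3) obtain z where "(z, y) \<in> A \<inter> U \<times> U" by (metis rtranclE)
        with \<open>sym A\<close> have "z \<in> U" "(y, z) \<in> A" by (auto dest: symD)
        with nbr[of y z] xy True show False by (auto simp: doubleton_eq_iff)
      next
        case False
        from path xy(3) obtain z where "(x, z) \<in> A \<inter> U \<times> U" by (metis converse_rtranclE)
        with nbr[of x z] xy False show False by (auto simp: doubleton_eq_iff)
      qed
    qed
  qed (use assms in auto)
  moreover have "card J \<le> card (J - {u}) + 1"
    by (metis card_Diff_singleton_if diff_le_self le_diff_conv order_refl)
  ultimately show ?thesis by linarith
qed

text \<open>Used in contrapositive form: a deletion that changes the components must have both ends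
  in \<open>U\<close> and separate them.\<close>

lemma components_delete_edge:
  assumes "sym A" and "u \<in> U \<Longrightarrow> v \<in> U \<Longrightarrow> (u, v) \<in> ((A - {(u, v), (v, u)}) \<inter> U \<times> U)\<^sup>*"
  shows "components U (A - {(u, v), (v, u)}) = components U A"
proof -
  let ?R = "A \<inter> U \<times> U" and ?R' = "(A - {(u, v), (v, u)}) \<inter> U \<times> U"
  have "sym ?R'" using assms(1) by (auto simp: sym_def)
  then have "sym (?R'\<^sup>*)" by (rule sym_rtrancl)
  with assms(2) have "?R \<subseteq> ?R'\<^sup>*" by (auto dest: symD)
  moreover have "?R' \<subseteq> ?R" by auto
  ultimately have "?R\<^sup>* = ?R'\<^sup>*" by (metis rtrancl_subset)
  then show ?thesis by (simp add: components_def)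
qed

text \<open>The hypothesis \<open>conn\<close> puts all edges into a single component, which the
  final summand counts; every other component comes from an isolated vertex.\<close>

lemma card_components_le_isolated:
  assumes "finite U" "sym A"
    and conn: "\<And>a b c d. \<lbrakk>(a, b) \<in> A \<inter> U \<times> U; (c, d) \<in> A \<inter> U \<times> U\<rbrakk>
      \<Longrightarrow> (A \<inter> U \<times> U)\<^sup>* `` {a} = (A \<inter> U \<times> U)\<^sup>* `` {c}"
  shows "card (components U A) \<le> card (isolated U A) + (if A \<inter> U \<times> U = {} then 0 else 1)"
proof -
  let ?R = "A \<inter> U \<times> U"
  let ?c = "\<lambda>v. ?R\<^sup>* `` {v}"
  have fin: "finite (isolated U A)" using assms(1) by (simp add: isolated_def)
  show ?thesis
  proof (cases "?R = {}")
    case True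
    then have "isolated U A = U" by (auto simp: isolated_def)
    then show ?thesis using assms(1) True by (simp add: components_def card_image_le)
  next
    case False
    then obtain a b where ab: "(a, b) \<in> ?R" by auto
    have "components U A \<subseteq> insert (?c a) (?c ` isolated U A)"
    proof
      fix C assume "C \<in> components U A"
      then obtain v where v: "v \<in> U" "C = ?c v" by (auto simp: components_def)
      show "C \<in> insert (?c a) (?c ` isolated U A)"
      proof (cases "v \<in> isolated U A")
        case False
        then obtain z where "(v, z) \<in> ?R" using v by (auto simp: isolated_def)
        then show ?thesis using conn[OF _ ab] v by simp
      qed (use v in auto)
    qed
    then have "card (components U A) \<le> card (insert (?c a) (?c ` isolated U A))"
      using fin by (intro card_mono) auto
    also have "\<dots> \<le> card (?c ` isolated U A) + 1"
      using fin by (simp add: card_insert_if)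
    also have "\<dots> \<le> card (isolated U A) + 1"
      using fin by (simp add: card_image_le)
    finally show ?thesis using False by simp
  qed
qed

text \<open>Components are disjoint, and each one other than \<open>C\<close> and \<open>D\<close>
  takes up at least one vertex of \<open>U\<close>.\<close>

lemma card_two_components_le:
  assumes "finite U" "sym A" "C \<in> components U A" "D \<in> components U A" "C \<noteq> D"
  shows "card C + card D + card (components U A) \<le> card U + 2"
proof -
  let ?K = "components U A"
  have fin: "finite ?K" using assms(1) by (simp add: components_def)
  have finC: "finite X" if "X \<in> ?K" for X
    using components_memb_subset[OF that] assms(1) finite_subset by blast
  have ne: "1 \<le> card X" if "X \<in> ?K" for X
    using that finC[OF that] by (auto simp: components_def Suc_le_eq card_gt_0_iff)
  have split: "?K = insert C (insert D (?K - {C, D}))" using assms by auto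
  have "sum card ?K = card C + card D + sum card (?K - {C, D})"
    using assms fin by (subst split) (simp add: sum.insert_remove)
  moreover have "card (?K - {C, D}) \<le> sum card (?K - {C, D})"
    using sum_mono[of "?K - {C, D}" "\<lambda>_. 1" card] ne by simp
  moreover have "card ?K = card (?K - {C, D}) + 2"
    using assms fin by (subst split) (simp add: card_insert_if)
  moreover have "sum card ?K = card (\<Union>?K)"
    using card_Union_disjoint[OF disjoint_components[OF assms(2)]] finC by metis
  moreover have "card (\<Union>?K) \<le> card U"
    using components_memb_subset assms(1) by (intro card_mono) blast+
  ultimately show ?thesis by linarith
qed

text \<open>The negation of the theorem for a bare relation: girth 4 enters as
  \<open>triangle_free\<close>, and \<open>tough\<close> and \<open>minimal\<close> unfold minimal
  1-toughness. The hypotheses are consistent with an empty \<open>E\<close>, so the goal is to show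
  that there are no edges.\<close>

locale dense_minimally_tough =
  fixes V :: "'a set" and E :: "'a rel" and \<delta> :: nat
  assumes finite_V: "finite V"
    and edges: "E \<subseteq> V \<times> V"
    and sym_E: "sym E"
    and loopfree: "(a, a) \<notin> E"
    and triangle_free: "\<lbrakk>(a, b) \<in> E; (b, c) \<in> E\<rbrakk> \<Longrightarrow> (a, c) \<notin> E"
    and min_degree: "v \<in> V \<Longrightarrow> \<delta> \<le> card (E `` {v})"
    and order: "card V + 7 \<le> 4 * \<delta>"
    and tough: "\<lbrakk>S \<subseteq> V; 2 \<le> card (components (V - S) E)\<rbrakk> \<Longrightarrow> card (components (V - S) E) \<le> card S"
    and minimal: "(u, v) \<in> E \<Longrightarrow> \<exists>S \<subseteq> V. 2 \<le> card (components (V - S) (E - {(u, v), (v, u)}))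
                    \<and> card S < card (components (V - S) (E - {(u, v), (v, u)}))"
begin

text \<open>
  \<open>I\<close> plays the role of the isolated vertices of \<open>(G - uv) - S\<close> for a set \<open>S\<close> witnessing that deleting
  \<open>uv\<close> lowers the toughness. They form an independent set apart from \<open>uv\<close>, and
  \<open>card S + 4 \<le> 2 * \<delta>\<close> says that each of them sees more than half of \<open>S\<close>.
\<close>

definition tight :: "'a \<Rightarrow> 'a \<Rightarrow> 'a set \<Rightarrow> 'a set \<Rightarrow> bool" where
  "tight u v S I \<longleftrightarrow> S \<subseteq> V \<and> I \<subseteq> V \<and> S \<inter> I = {} \<and> card S \<le> card I \<and> card S + 4 \<le> 2 * \<delta>
     \<and> u \<notin> S \<and> v \<notin> S \<and> (u \<in> I \<or> v \<in> I) \<and> I \<noteq> {}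
     \<and> (\<forall>y \<in> I. \<forall>z. (y, z) \<in> E \<longrightarrow> z \<in> S \<or> {y, z} = {u, v})"

lemma symE: "(a, b) \<in> E \<Longrightarrow> (b, a) \<in> E"
  using sym_E by (auto dest: symD)

lemma finite_sub: "X \<subseteq> V \<Longrightarrow> finite X"
  using finite_V finite_subset by blast

lemma nbrs_V: "E `` {v} \<subseteq> V"
  using edges by auto

lemma finite_nbrs: "finite (E `` {v})"
  using nbrs_V finite_sub by blast

section \<open>Tight pairs from deleted edges\<close>

lemma edge_nbrs:
  assumes "(a, b) \<in> E"
  shows "2 * \<delta> \<le> card (E `` {a} \<union> E `` {b})"
proof -
  have "E `` {a} \<inter> E `` {b} = {}"
    using triangle_free assms by blast
  then have "card (E `` {a} \<union> E `` {b}) = card (E `` {a}) + card (E `` {b})"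
    by (intro card_Un_disjoint finite_nbrs)
  moreover have "a \<in> V" "b \<in> V" using assms edges by auto
  ultimately show ?thesis using min_degree[of a] min_degree[of b] by linarith
qed

text \<open>The disjoint neighbourhoods of \<open>a\<close> and \<open>b\<close> fit into the
  component, \<open>S\<close> and one further vertex reached along the deleted edge.\<close>

lemma nontrivial_component_size:
  fixes u v S
  defines "R \<equiv> (E - {(u, v), (v, u)}) \<inter> (V - S) \<times> (V - S)"
  assumes "S \<subseteq> V" "(a, b) \<in> R"
  shows "2 * \<delta> \<le> card (R\<^sup>* `` {a}) + card S + 1"
proof -
  let ?C = "R\<^sup>* `` {a}"
  \<comment> \<open>The deleted edge leads out of \<open>?C\<close> only if exactly one of its ends
    lies in \<open>?C\<close>; then \<open>w\<close> is the other end.\<close>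
  define w where "w = (if u \<in> ?C then v else u)"
  have "?C \<in> components (V - S) (E - {(u, v), (v, u)})"
    using assms by (auto simp: components_def R_def)
  from components_memb_subset[OF this] have "?C \<subseteq> V" by auto
  then have finC: "finite ?C" by (rule finite_sub)
  have finS: "finite S" using assms finite_sub by blast
  have "z \<in> insert w (?C \<union> S)" if "x \<in> ?C" "x \<in> V - S" "(x, z) \<in> E" for x z
  proof (cases "z \<in> S \<or> (x, z) \<in> R")
    case True
    then show ?thesis using that(1) by (auto intro: rtrancl_into_rtrancl)
  next
    case False
    then have "(x, z) \<in> {(u, v), (v, u)}"
      using that edges by (auto simp: R_def)
    then show ?thesis using that(1) by (auto simp: w_def)
  qed
  moreover have "a \<in> ?C" "b \<in> ?C" "a \<in> V - S" "b \<in> V - S" "(a, b) \<in> E"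
    using assms by (auto simp: R_def)
  ultimately have "E `` {a} \<union> E `` {b} \<subseteq> insert w (?C \<union> S)" by blast
  then have "card (E `` {a} \<union> E `` {b}) \<le> card (insert w (?C \<union> S))"
    using finC finS by (intro card_mono) auto
  also have "\<dots> \<le> card (?C \<union> S) + 1"
    using finC finS by (simp add: card_insert_if)
  also have "\<dots> \<le> card ?C + card S + 1"
    by (simp add: card_Un_le)
  finally show ?thesis using edge_nbrs[OF \<open>(a, b) \<in> E\<close>] by linarith
qed

lemma tight_exists:
  assumes "(u, v) \<in> E"
  shows "\<exists>S I. tight u v S I"
proof -
  let ?A = "E - {(u, v), (v, u)}"
  obtain S where S: "S \<subseteq> V" "2 \<le> card (components (V - S) ?A)"
      "card S < card (components (V - S) ?A)"
    using minimal[OF assms] by blast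
  let ?U = "V - S"
  let ?R = "?A \<inter> ?U \<times> ?U"
  let ?I = "isolated ?U ?A"
  have finU: "finite ?U" using finite_V by simp
  have symA: "sym ?A" using sym_E by (auto simp: sym_def)
  have cardV: "card V = card S + card ?U"
    using S(1) finite_V card_Diff_subset[of S V] card_mono[of V S] finite_sub by simp
  have uv: "u \<in> ?U \<and> v \<in> ?U \<and> (u, v) \<notin> ?R\<^sup>*"
  proof (rule ccontr)
    assume "\<not> ?thesis"
    then have "components ?U ?A = components ?U E"
      by (intro components_delete_edge sym_E) blast
    then show False using tough[OF S(1)] S by simp
  qed
  \<comment> \<open>With k = \<open>card S\<close>, two nontrivial components would give 2(2\<delta>
    - k - 1) + (k + 1) \<le> (n - k) + 2, that is, 4\<delta> \<le> n + 3.\<close>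
  have conn: "?R\<^sup>* `` {a} = ?R\<^sup>* `` {c}" if "(a, b) \<in> ?R" "(c, d) \<in> ?R" for a b c d
  proof (rule ccontr)
    assume ne: "?R\<^sup>* `` {a} \<noteq> ?R\<^sup>* `` {c}"
    have "card (?R\<^sup>* `` {a}) + card (?R\<^sup>* `` {c}) + card (components ?U ?A) \<le> card ?U + 2"
      using that by (intro card_two_components_le finU symA ne) (auto simp: components_def)
    then show False
      using nontrivial_component_size[OF S(1) that(1)] nontrivial_component_size[OF S(1) that(2)]
        S(3) cardV order by linarith
  qed
  have cI: "card (components ?U ?A) \<le> card ?I + (if ?R = {} then 0 else 1)"
    by (intro card_components_le_isolated finU symA conn)
  \<comment> \<open>This yields 2k + 1 \<le> n \<le> 4\<delta> - 7, hence the bound k \<le>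
    2\<delta> - 4 in \<open>tight\<close>.\<close>
  have U: "card S + 1 \<le> card ?U"
  proof (cases "?R = {}")
    case True
    have "card ?I \<le> card ?U" using finU by (intro card_mono) (auto simp: isolated_def)
    then show ?thesis using True cI S by simp
  next
    case False
    then have "?I \<subset> ?U" by (auto simp: isolated_def)
    then have "card ?I < card ?U" using finU by (intro psubset_card_mono)
    then show ?thesis using False cI S by simp
  qed
  \<comment> \<open>Otherwise both ends lie in the only nontrivial component, although they are
    separated.\<close>
  have "u \<in> ?I \<or> v \<in> ?I"
  proof (rule ccontr)
    assume "\<not> ?thesis"
    then obtain z z' where "(u, z) \<in> ?R" "(v, z') \<in> ?R"
      using uv unfolding isolated_def by blast
    from conn[OF this] uv show False by auto
  qed
  moreover have "card S \<le> card ?I" using cI S by (simp split: if_splits)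
  moreover have "card S + 4 \<le> 2 * \<delta>" using U cardV order by linarith
  moreover have "z \<in> S \<or> {y, z} = {u, v}" if "y \<in> ?I" "(y, z) \<in> E" for y z
    using that edges by (auto simp: isolated_def)
  moreover have "?I \<subseteq> V" "S \<inter> ?I = {}" by (auto simp: isolated_def)
  ultimately have "tight u v S ?I"
    using S(1) uv by (auto simp: tight_def)
  then show ?thesis by blast
qed

section \<open>Degree counts in a tight pair\<close>

lemma finite_tight: "tight u v S I \<Longrightarrow> finite S \<and> finite I"
  using finite_sub by (simp add: tight_def)

lemma tight_nbr:
  assumes "tight u v S I" "y \<in> I" "(y, z) \<in> E"
  shows "z \<in> S \<or> {y, z} = {u, v}"
  using assms by (auto simp: tight_def)

lemma card_nbrs_outside:
  assumes "tight u v S I" "y \<in> I"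
  shows "card (E `` {y} - S) \<le> (if y \<in> {u, v} then 1 else 0)"
proof -
  have "E `` {y} - S \<subseteq> (if y \<in> {u, v} then {if y = u then v else u} else {})"
    using tight_nbr[OF assms] by (auto simp: doubleton_eq_iff)
  from card_mono[OF _ this] show ?thesis by (cases "y \<in> {u, v}") auto
qed

text \<open>A vertex outside \<open>S\<close> can reach \<open>I\<close> only along the edge
  \<open>uv\<close>.\<close>

lemma card_nbrs_in_isolated:
  assumes "tight u v S I" "z \<notin> S"
  shows "card (E `` {z} \<inter> I) \<le> 1"
proof -
  have "E `` {z} \<inter> I \<subseteq> {if z = u then v else u}"
    using tight_nbr[OF assms(1) _ symE, of _ z] assms(2) by (auto simp: doubleton_eq_iff)
  from card_mono[OF _ this] show ?thesis by simp
qed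

lemma degree_isolated_le:
  assumes "tight u v S I" "y \<in> I"
  shows "\<delta> \<le> card {s \<in> S. (y, s) \<in> E} + (if y \<in> {u, v} then 1 else 0)"
proof -
  have "y \<in> V" using assms by (auto simp: tight_def)
  then have "\<delta> \<le> card (E `` {y})" by (rule min_degree)
  also have "E `` {y} = {s \<in> S. (y, s) \<in> E} \<union> (E `` {y} - S)" by auto
  also have "card \<dots> \<le> card {s \<in> S. (y, s) \<in> E} + card (E `` {y} - S)" by (rule card_Un_le)
  finally show ?thesis using card_nbrs_outside[OF assms] by linarith
qed

lemma card_separator_ge:
  assumes "tight u v S I"
  shows "\<delta> \<le> card S + 1"
proof -
  obtain y where y: "y \<in> I" using assms by (auto simp: tight_def)
  have "card {s \<in> S. (y, s) \<in> E} \<le> card S"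
    using finite_tight[OF assms] by (intro card_mono) auto
  then show ?thesis using degree_isolated_le[OF assms y] by (simp split: if_splits)
qed

lemma delta_ge_4:
  assumes "(a, b) \<in> E"
  shows "4 \<le> \<delta>"
proof -
  have "card (E `` {a} \<union> E `` {b}) \<le> card V"
    using nbrs_V finite_V by (intro card_mono) auto
  then show ?thesis using edge_nbrs[OF assms] order by linarith
qed

text \<open>Double counting of the edges between \<open>I\<close> and \<open>S\<close>: there are at
  least |I|\<delta> - 2, where 2 accounts for the edge \<open>uv\<close>. If each vertex of
  \<open>S\<close> had at most \<delta> - 1 of them, then |S| \<le> |I| would force |S| \<le> 2,
  against |S| \<ge> \<delta> - 1 \<ge> 3.\<close>

lemma heavy_separator_vertex:
  assumes t: "tight u v S I" and "4 \<le> \<delta>"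
  shows "\<exists>s \<in> S. \<delta> \<le> card {y \<in> I. (y, s) \<in> E}"
proof (rule ccontr)
  assume "\<not> ?thesis"
  then have light: "card {y \<in> I. (y, s) \<in> E} \<le> \<delta> - 1" if "s \<in> S" for s
    using that by fastforce
  have fin: "finite S" "finite I" using finite_tight[OF t] by auto
  have "card I * \<delta> \<le> (\<Sum>y\<in>I. card {s \<in> S. (y, s) \<in> E} + (if y \<in> {u, v} then 1 else 0))"
    using sum_mono[OF degree_isolated_le[OF t]] by simp
  also have "\<dots> = (\<Sum>y\<in>I. card {s \<in> S. (y, s) \<in> E}) + card (I \<inter> {u, v})"
    using fin by (simp add: sum.distrib sum.If_cases Int_def)
  also have "(\<Sum>y\<in>I. card {s \<in> S. (y, s) \<in> E}) = (\<Sum>s\<in>S. card {y \<in> I. (y, s) \<in> E})"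
    by (rule sum_multicount_gen[OF fin(2,1)]) simp
  also have "\<dots> \<le> card S * (\<delta> - 1)"
    using sum_mono[OF light] by simp
  also have "card (I \<inter> {u, v}) \<le> 2"
    using card_mono[of "{u, v}" "I \<inter> {u, v}"] card_insert_le_m1[of 2 "{v}" u] by simp
  finally have "card I * \<delta> \<le> card S * (\<delta> - 1) + 2" by simp
  moreover have "card S * \<delta> \<le> card I * \<delta>" using t by (simp add: tight_def)
  moreover have "card S * \<delta> = card S * (\<delta> - 1) + card S"
    using \<open>4 \<le> \<delta>\<close> by (cases \<delta>) auto
  ultimately show False using card_separator_ge[OF t] \<open>4 \<le> \<delta>\<close> by linarith
qed

section \<open>Uncrossing two tight pairs\<close>

lemma no_edges: "E = {}"
proof (rule ccontr)
  assume "E \<noteq> {}"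
  then obtain u v where uv: "(u, v) \<in> E" by auto
  note \<delta> = delta_ge_4[OF uv]
  obtain S I where t: "tight u v S I" using tight_exists[OF uv] by blast
  obtain s where s: "s \<in> S" "\<delta> \<le> card {y \<in> I. (y, s) \<in> E}"
    using heavy_separator_vertex[OF t \<delta>] by blast
  \<comment> \<open>At least four neighbours of \<open>s\<close> lie in \<open>I\<close>, so one
    avoids \<open>u\<close> and \<open>v\<close>; all neighbours of that vertex \<open>x\<close>
    then lie in \<open>S\<close>.\<close>
  have "\<not> {y \<in> I. (y, s) \<in> E} \<subseteq> {u, v}"
    using card_mono[of "{u, v}" "{y \<in> I. (y, s) \<in> E}"] card_insert_le_m1[of 2 "{v}" u] s(2) \<delta>
    by auto
  then obtain x where x: "x \<in> I" "(x, s) \<in> E" "x \<notin> {u, v}" by auto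
  obtain S' I' where t': "tight x s S' I'" using tight_exists[OF x(2)] by blast
  note fin = conjunct1[OF finite_tight[OF t]] conjunct2[OF finite_tight[OF t]]
    conjunct1[OF finite_tight[OF t']] conjunct2[OF finite_tight[OF t']]
  have "x \<noteq> s" using x(2) loopfree by auto
  have S: "S \<subseteq> V" "I \<subseteq> V" "S \<inter> I = {}" "card S \<le> card I" "card S + 4 \<le> 2 * \<delta>"
    using t by (auto simp: tight_def)
  have S': "S' \<subseteq> V" "I' \<subseteq> V" "S' \<inter> I' = {}" "card S' \<le> card I'" "card S' + 4 \<le> 2 * \<delta>"
    "x \<notin> S'" "s \<notin> S'" "x \<in> I' \<or> s \<in> I'"
    using t' by (auto simp: tight_def)
  have nbr_x: "E `` {x} \<subseteq> S"
    using tight_nbr[OF t x(1)] x(3) by auto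
  have deg_x: "\<delta> \<le> card (E `` {x})" using x(1) S(2) min_degree by blast
  have nbr: "z \<in> S \<or> {y, z} = {u, v}" if "y \<in> I" "(y, z) \<in> E" for y z
    using tight_nbr[OF t that] .
  have nbr': "z \<in> S' \<or> {y, z} = {x, s}" if "y \<in> I'" "(y, z) \<in> E" for y z
    using tight_nbr[OF t' that] .
  have "s \<notin> I'"
  proof
    assume sI': "s \<in> I'"
    have "{y \<in> I. (y, s) \<in> E} \<subseteq> insert x (I \<inter> S')"
      using nbr'[OF sI' symE] \<open>x \<noteq> s\<close> by (auto simp: doubleton_eq_iff)
    then have "card {y \<in> I. (y, s) \<in> E} \<le> card (insert x (I \<inter> S'))"
      using fin by (intro card_mono) auto
    also have "\<dots> \<le> card (I \<inter> S') + 1" using fin by (simp add: card_insert_if)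
    \<comment> \<open>As |S'| \<le> 2\<delta> - 4, at most \<delta> - 3 vertices of
      \<open>S'\<close> remain outside \<open>I\<close>.\<close>
    finally have IS': "\<delta> \<le> card (I \<inter> S') + 1" using s(2) by linarith
    have split: "card S' = card (I \<inter> S') + card (S' - I)"
      using fin by (subst card_Un_disjoint[symmetric]) (auto intro: arg_cong[of _ _ card])
    have "I' \<subseteq> S"
    proof
      fix z assume z: "z \<in> I'"
      show "z \<in> S"
      proof (rule ccontr)
        assume "z \<notin> S"
        \<comment> \<open>At most one neighbour of \<open>z\<close> is outside \<open>S'\<close>, at
          most one is in \<open>I\<close>, and at most \<delta> - 3 are in \<open>S' - I\<close>:
          fewer than \<delta> in all.\<close>
        have "E `` {z} \<subseteq> (E `` {z} - S') \<union> (E `` {z} \<inter> I) \<union> (S' - I)" by auto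
        then have "card (E `` {z}) \<le> card ((E `` {z} - S') \<union> (E `` {z} \<inter> I) \<union> (S' - I))"
          using fin finite_nbrs by (intro card_mono) auto
        also have "\<dots> \<le> card (E `` {z} - S') + card (E `` {z} \<inter> I) + card (S' - I)"
          by (meson add_le_mono1 card_Un_le order_trans)
        also have "\<dots> \<le> 1 + 1 + card (S' - I)"
          using card_nbrs_outside[OF t' z] card_nbrs_in_isolated[OF t \<open>z \<notin> S\<close>]
          by (simp split: if_splits)
        finally have "\<delta> \<le> card (S' - I) + 2"
          using min_degree[of z] z S'(2) by (auto intro: order_trans)
        then show False using IS' split S'(5) by linarith
      qed
    qed
    have "E `` {x} \<inter> I' \<subseteq> {s}"
      using nbr'[OF _ symE, of _ x] S'(6) \<open>x \<noteq> s\<close> by (auto simp: doubleton_eq_iff)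
    then have "E `` {x} \<subseteq> insert s (S - I')" using nbr_x by auto
    then have "card (E `` {x}) \<le> card (insert s (S - I'))"
      using fin by (intro card_mono) auto
    also have "\<dots> \<le> card (S - I') + 1" using fin by (simp add: card_insert_if)
    also have "card (S - I') = card S - card I'"
      using fin \<open>I' \<subseteq> S\<close> by (simp add: card_Diff_subset)
    finally have "\<delta> \<le> card S - card I' + 1" using deg_x by linarith
    \<comment> \<open>Here |I'| \<ge> |S'| \<ge> \<delta> - 1 bounds the degree of \<open>x\<close>
      by \<delta> - 2; if the natural subtraction truncates to 0, \<delta> \<ge> 4 is contradicted
      instead.\<close>
    then show False using S(5) S'(4) IS' split \<delta> by linarith
  qed
  then have xI': "x \<in> I'" using S'(8) by simp
  have "E `` {x} \<subseteq> insert s (S \<inter> S')"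
    using nbr_x nbr'[OF xI'] \<open>x \<noteq> s\<close> by (auto simp: doubleton_eq_iff)
  then have "card (E `` {x}) \<le> card (insert s (S \<inter> S'))"
    using fin by (intro card_mono) auto
  also have "\<dots> \<le> card (S \<inter> S') + 1" using fin by (simp add: card_insert_if)
  finally have SS': "\<delta> \<le> card (S \<inter> S') + 1" using deg_x by linarith
  \<comment> \<open>Since \<open>s\<close> is outside \<open>S'\<close>, its only possible neighbour
    in \<open>I'\<close> is \<open>x\<close>.\<close>
  have "{y \<in> I. (y, s) \<in> E} \<subseteq> insert x (I - I')"
    using nbr' S'(7) \<open>x \<noteq> s\<close> by (auto simp: doubleton_eq_iff)
  then have "card {y \<in> I. (y, s) \<in> E} \<le> card (insert x (I - I'))"
    using fin by (intro card_mono) auto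
  also have "\<dots> \<le> card (I - I') + 1" using fin by (simp add: card_insert_if)
  finally have II': "\<delta> \<le> card (I - I') + 1" using s(2) by linarith
  define W where "W = (S - I') \<union> (S' - I)"
  define J where "J = (I - S') \<union> (I' - S)"
  have "card J \<le> card (components (V - W) E) + 1"
  proof (rule card_almost_isolated_le)
    fix y z assume y: "y \<in> J" and z: "z \<in> V - W" and yz: "(y, z) \<in> E"
    from y consider "y \<in> I" "y \<notin> S'" | "y \<in> I'" "y \<notin> S" by (auto simp: J_def)
    then show "{y, z} = {u, v}"
    proof cases
      case 1
      show ?thesis
      proof (rule ccontr)
        assume "{y, z} \<noteq> {u, v}"
        \<comment> \<open>A vertex of \<open>S\<close> outside \<open>W\<close> must be in
          \<open>I'\<close>. Its edge to \<open>y\<close>, which is not in \<open>S'\<close>, is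
          then \<open>xs\<close>, so it would be \<open>s\<close>.\<close>
        with nbr[OF 1(1) yz] z have "z \<in> S" "z \<in> I'" by (auto simp: W_def)
        with nbr'[OF _ symE[OF yz]] 1(2) have "{z, y} = {x, s}" by auto
        with \<open>z \<in> S\<close> \<open>z \<in> I'\<close> x(1) S(3) \<open>s \<notin> I'\<close> show False by (auto simp: doubleton_eq_iff)
      qed
    next
      case 2
      \<comment> \<open>The edge \<open>xs\<close> does not survive the removal of \<open>W\<close>,
        because \<open>s\<close> lies in \<open>S - I'\<close>.\<close>
      have "{y, z} \<noteq> {x, s}"
        using 2 z s(1) \<open>s \<notin> I'\<close> by (auto simp: W_def doubleton_eq_iff)
      with nbr'[OF 2(1) yz] z have "z \<in> I" by (auto simp: W_def)
      with nbr[OF _ symE[OF yz]] 2(2) show ?thesis by (auto simp: insert_commute)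
    qed
  qed (use finite_V sym_E S(2,3) S'(2,3) in \<open>auto simp: J_def W_def\<close>)
  moreover have "card (components (V - W) E) \<le> card W"
  proof (cases "2 \<le> card (components (V - W) E)")
    case True
    then show ?thesis using S(1) S'(1) by (intro tough) (auto simp: W_def)
  next
    \<comment> \<open>With fewer than two components \<open>tough\<close> is silent, but
      \<open>s\<close> makes \<open>W\<close> nonempty.\<close>
    case False
    have "s \<in> W" using s(1) \<open>s \<notin> I'\<close> by (simp add: W_def)
    then have "card W \<noteq> 0" using fin by (auto simp: W_def)
    then show ?thesis using False by linarith
  qed
  ultimately have JW: "card J \<le> card W + 1" by linarith
  have "card W + card (S \<inter> S') = card (S - I') + card (S' - I)"
  proof -
    have "S \<inter> S' = (S - I') \<inter> (S' - I)" using S(3) S'(3) by auto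
    then show ?thesis unfolding W_def using fin card_Un_Int[of "S - I'" "S' - I"] by simp
  qed
  moreover have "card J + card (I \<inter> I') = card (I - S') + card (I' - S)"
  proof -
    have "I \<inter> I' = (I - S') \<inter> (I' - S)" using S(3) S'(3) by auto
    then show ?thesis unfolding J_def using fin card_Un_Int[of "I - S'" "I' - S"] by simp
  qed
  moreover have diff: "card A = card (A - B) + card (A \<inter> B)" if "finite A" for A B :: "'a set"
    using that card_Int_Diff[of A B] by simp
  moreover note diff[OF fin(1), of I'] diff[OF fin(3), of I] diff[OF fin(2), of S']
    diff[OF fin(4), of S] diff[OF fin(2), of I']
  \<comment> \<open>Substituting gives \<delta> - 1 \<le> |S \<inter> S'| \<le> (|I| - \<delta> + 1)
    + 1 + (|S| - |I|), so |S| \<ge> 2\<delta> - 3.\<close>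
  ultimately show False
    using JW SS' II' S(4,5) S'(4) by (simp add: Int_commute)
qed

end

section \<open>Translating toughness and girth into the locale's hypotheses\<close>

lemma finite_toughness_set:
  assumes "finite (pverts H)"
  shows "finite {ereal (real (card S) / real (num_components (delete_vertices H S))) | S.
                 S \<subseteq> pverts H \<and> num_components (delete_vertices H S) \<ge> 2}"
  using finite_Collect_subsets[OF assms]
  by (rule finite_surj[where f = "\<lambda>S. ereal (real (card S) / real (num_components (delete_vertices H S)))"])
     auto

lemma le_toughnessD:
  assumes "finite (pverts H)" "1 \<le> toughness H" "toughness H \<noteq> \<infinity>"
    and "S \<subseteq> pverts H" "2 \<le> num_components (delete_vertices H S)"
  shows "num_components (delete_vertices H S) \<le> card S"
proof -
  let ?r = "ereal (real (card S) / real (num_components (delete_vertices H S)))"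
  have "toughness H \<le> ?r"
    using assms(3-5) finite_toughness_set[OF assms(1)]
    by (auto simp: toughness_def split: if_splits intro!: Min_le)
  with assms(2) have "1 \<le> ?r" by (rule order_trans)
  then show ?thesis using assms(5) by (simp add: field_simps split: if_splits)
qed

text \<open>A small \<open>Min\<close> yields a witness only if the set of ratios is nonempty. The
  nonadjacent pair \<open>u\<close>, \<open>v\<close>, later the ends of the deleted edge, ensures
  this.\<close>

lemma toughness_lessD:
  assumes G: "pair_graph H" and "toughness H < 1"
    and uv: "u \<in> pverts H" "v \<in> pverts H" "u \<noteq> v" "(u, v) \<notin> parcs H"
  shows "\<exists>S \<subseteq> pverts H. 2 \<le> num_components (delete_vertices H S)
           \<and> card S < num_components (delete_vertices H S)"
proof -
  interpret pair_graph H by fact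
  let ?T = "{ereal (real (card S) / real (num_components (delete_vertices H S))) | S.
                 S \<subseteq> pverts H \<and> num_components (delete_vertices H S) \<ge> 2}"
  \<comment> \<open>Removing everything except \<open>u\<close> and \<open>v\<close> leaves two
    components.\<close>
  let ?S0 = "pverts H - {u, v}"
  have U: "pverts H - ?S0 = {u, v}" using uv by auto
  have "(v, u) \<notin> parcs H" using uv(4) pair_sym_arcs by (auto simp: symmetric_def sym_def)
  then have R: "parcs H \<inter> {u, v} \<times> {u, v} = {}"
    using uv(4) pair_no_loops by fastforce
  have "card {u, v} \<le> card (components {u, v} (parcs H))"
    by (rule card_le_card_components) (auto simp only: R rtrancl_empty)
  then have "2 \<le> num_components (delete_vertices H ?S0)"
    using uv(3) by (simp only: num_components_delete_vertices[OF G] U) simp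
  then have "?T \<noteq> {}" by blast
  moreover have "toughness H = Min ?T"
    using assms(2) by (auto simp: toughness_def)
  ultimately have "toughness H \<in> ?T"
    using Min_in[OF finite_toughness_set[OF pair_finite_verts]] by simp
  then obtain S where S: "S \<subseteq> pverts H" "2 \<le> num_components (delete_vertices H S)"
    "toughness H = ereal (real (card S) / real (num_components (delete_vertices H S)))"
    by auto
  with assms(2) have "card S < num_components (delete_vertices H S)"
    by (simp add: field_simps split: if_splits)
  with S show ?thesis by blast
qed

lemma pair_graph_delete_edge:
  assumes "pair_graph G"
  shows "pair_graph (delete_edge G e)"
proof -
  interpret pair_graph G by fact
  show ?thesis
    using pair_finite_verts pair_finite_arcs pair_sym_arcs pair_no_loops arc_fst_in_verts arc_snd_in_verts
    by unfold_locales (auto simp: delete_edge_def symmetric_def sym_def)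
qed

lemma girth_le_3_if_triangle:
  assumes "pair_graph G" "(a, b) \<in> parcs G" "(b, c) \<in> parcs G" "(a, c) \<in> parcs G"
  shows "girth G \<le> 3"
proof -
  interpret pair_graph G by fact
  have ca: "(c, a) \<in> parcs G" using assms(4) pair_sym_arcs by (auto simp: symmetric_def sym_def)
  have "a \<noteq> b" "b \<noteq> c" "a \<noteq> c" using assms(2-4) pair_no_loops by fastforce+
  then have "cycle [(a, b), (b, c), (c, a)]"
    using assms(2-3) ca in_arcsD1 unfolding cycle_def awalk_def by auto
  then have "girth G \<le> enat 3"
    unfolding girth_def by (intro INF_lower2[of "[(a, b), (b, c), (c, a)]"]) auto
  then show ?thesis unfolding numeral_eq_enat .
qed

lemma girth_no_arcs:
  assumes "pair_graph G" "parcs G = {}"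
  shows "girth G = \<infinity>"
proof -
  interpret pair_graph G by fact
  have "\<not> cycle p" for p
    using assms(2) by (auto simp: cycle_def awalk_def)
  then show ?thesis by (simp add: girth_def top_enat_def)
qed

lemma out_degree_with_proj: "out_degree (with_proj G) v = card (parcs G `` {v})"
proof -
  have "bij_betw snd (out_arcs (with_proj G) v) (parcs G `` {v})"
    by (rule bij_betw_byWitness[where f' = "\<lambda>w. (v, w)"]) (auto simp: out_arcs_def)
  then show ?thesis unfolding out_degree_def by (rule bij_betw_same_card)
qed

theorem theorem2p2:
  fixes G :: "'a pair_pre_digraph" and n :: nat
  assumes "pair_graph G"
    and "card (pverts G) = n"
    and "minimally_tough 1 G"
    and "girth G = 4"
  shows "\<exists>v \<in> pverts G. real (out_degree (with_proj G) v) \<le> (real n + 6) / 4"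
proof (rule ccontr)
  assume "\<not> ?thesis"
  then have deg: "n + 7 \<le> 4 * card (parcs G `` {v})" if "v \<in> pverts G" for v
    using that by (fastforce simp: out_degree_with_proj not_le)
  interpret pair_graph G by fact
  have t: "toughness G = 1" and del: "\<And>e. e \<in> parcs G \<Longrightarrow> toughness (delete_edge G e) < 1"
    using assms(3) by (auto simp: minimally_tough_def one_ereal_def)
  have "parcs G \<noteq> {}" using girth_no_arcs[OF assms(1)] assms(4) by auto
  \<comment> \<open>The value is (n + 7)/4 rounded up, the least integer \<delta> with 4\<delta>
    \<ge> n + 7.\<close>
  have "dense_minimally_tough (pverts G) (parcs G) ((n + 10) div 4)"
  proof
    show "finite (pverts G)" by (rule pair_finite_verts)
    show "parcs G \<subseteq> pverts G \<times> pverts G" using in_arcsD1 in_arcsD2 by auto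
    show "sym (parcs G)" using pair_sym_arcs by (simp add: symmetric_def)
    show "(a, a) \<notin> parcs G" for a using pair_no_loops by fastforce
    show "(a, c) \<notin> parcs G" if "(a, b) \<in> parcs G" "(b, c) \<in> parcs G" for a b c
      using girth_le_3_if_triangle[OF assms(1) that] assms(4) by auto
    show "(n + 10) div 4 \<le> card (parcs G `` {v})" if "v \<in> pverts G" for v
      using deg[OF that] by linarith
    show "card (pverts G) + 7 \<le> 4 * ((n + 10) div 4)"
      using assms(2) by presburger
    show "card (components (pverts G - S) (parcs G)) \<le> card S"
      if "S \<subseteq> pverts G" "2 \<le> card (components (pverts G - S) (parcs G))" for S
      using le_toughnessD[OF pair_finite_verts _ _ that(1)] that(2) t
      by (simp add: num_components_delete_vertices[OF assms(1)])
    show "\<exists>S \<subseteq> pverts G. 2 \<le> card (components (pverts G - S) (parcs G - {(u, v), (v, u)}))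
            \<and> card S < card (components (pverts G - S) (parcs G - {(u, v), (v, u)}))"
      if uv: "(u, v) \<in> parcs G" for u v
    proof -
      have "u \<noteq> v" using uv pair_no_loops by fastforce
      note G' = pair_graph_delete_edge[OF assms(1), of "(u, v)"]
      show ?thesis
        using toughness_lessD[OF G' del[OF uv], of u v] uv \<open>u \<noteq> v\<close> in_arcsD1 in_arcsD2
        by (simp add: num_components_delete_vertices[OF G']) (simp add: delete_edge_def)
    qed
  qed
  then show False using dense_minimally_tough.no_edges \<open>parcs G \<noteq> {}\<close> by blast
qed

end
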